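(* Let $\psi$ and $\varphi$ be analytic functions on the open unit disk $\mathbb{D}$ with $\varphi(\mathbb{D})\subseteq\mathbb{D}$, and let $H^2(\beta)$ be a weighted Hardy space with weight sequence $\beta$. Suppose that the weighted composition operator $W_{\psi,\varphi}$, $W_{\psi,\varphi}f=\psi\cdot(f\circ\varphi)$, is a bounded, invertible operator on $H^2(\beta)$. Then $\varphi$ must be an automorphism of $\mathbb{D}$. Moreover, if $\liminf_{j\to\infty}\beta(j)^{1/j}>1$, then $\varphi$ must be a rotation automorphism, that is, there is $\zeta\in\partial\mathbb{D}$ with $\varphi(z)=\zeta z$ for all $z\in\mathbb{D}$.
   Context: $\mathbb{D}=\{z\in\mathbb{C}:|z|<1\}$. A weighted Hardy space is a Hilbert space of functions analytic on $\mathbb{D}$ in which the polynomials are dense and the monomials $1,z,z^2,\dots$ form an orthogonal set of nonzero vectors. Its weight sequence is $\beta(j)=\|z^j\|>0$, $j\ge 0$, normalized by $\beta(0)=1$. Concretely, $H^2(\beta)$ consists of the functions $f$ analytic on $\mathbb{D}$ whose Maclaurin coefficients $\hat f(j)$ satisfy $\sum_{j=0}^\infty|\hat f(j)|^2\beta(j)^2<\infty$, with inner product $\langle f,g\rangle=\sum_{j=0}^\infty\hat f(j)\overline{\hat g(j)}\beta(j)^2$. The requirement that all elements of the Hilbert space be analytic on $\mathbb{D}$ is equivalent to $\liminf_{j\to\infty}\beta(j)^{1/j}\ge 1$, which holds for every weighted Hardy space; the value $\liminf_{j\to\infty}\beta(j)^{1/j}=\infty$ is allowed and counts as $>1$. An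 automorphism of $\mathbb{D}$ is an analytic bijection of $\mathbb{D}$ onto $\mathbb{D}$. *)

theory Defs
  imports "HOL-Complex_Analysis.Complex_Analysis"
begin

abbreviation unit_disk :: "complex set" where
  "unit_disk \<equiv> ball 0 1"

definition maclaurin_coeff :: "(complex \<Rightarrow> complex) \<Rightarrow> nat \<Rightarrow> complex" where
  "maclaurin_coeff f j = (deriv ^^ j) f 0 / fact j"

(* A function on the disk is represented by its extension by zero to the whole plane, so that
   equality of elements is equality of functions on the disk and the vector space operations
   are pointwise. *)
definition hardy_space :: "(nat \<Rightarrow> real) \<Rightarrow> (complex \<Rightarrow> complex) set" where
  "hardy_space \<beta> = {f. f holomorphic_on unit_disk \<and> (\<forall>z. z \<notin> unit_disk \<longrightarrow> f z = 0) \<and>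
     summable (\<lambda>j. (cmod (maclaurin_coeff f j))\<^sup>2 * (\<beta> j)\<^sup>2)}"

definition hardy_inner ::
  "(nat \<Rightarrow> real) \<Rightarrow> (complex \<Rightarrow> complex) \<Rightarrow> (complex \<Rightarrow> complex) \<Rightarrow> complex" where
  "hardy_inner \<beta> f g =
     (\<Sum>j. maclaurin_coeff f j * cnj (maclaurin_coeff g j) * complex_of_real ((\<beta> j)\<^sup>2))"

definition hardy_norm :: "(nat \<Rightarrow> real) \<Rightarrow> (complex \<Rightarrow> complex) \<Rightarrow> real" where
  "hardy_norm \<beta> f = sqrt (Re (hardy_inner \<beta> f f))"

(* The last conjunct is the requirement that all elements of the Hilbert space be analytic on
   the disk: every coefficient sequence in the weighted l2 space comes from a member of
   hardy_space. It makes hardy_space complete, and is equivalent to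
   liminf (root j (beta j)) >= 1. *)
definition hardy_weight :: "(nat \<Rightarrow> real) \<Rightarrow> bool" where
  "hardy_weight \<beta> \<longleftrightarrow> \<beta> 0 = 1 \<and> (\<forall>j. \<beta> j > 0) \<and>
     (\<forall>a. summable (\<lambda>j. (cmod (a j))\<^sup>2 * (\<beta> j)\<^sup>2) \<longrightarrow>
        (\<exists>f\<in>hardy_space \<beta>. \<forall>j. maclaurin_coeff f j = a j))"

definition weighted_comp_op ::
  "(complex \<Rightarrow> complex) \<Rightarrow> (complex \<Rightarrow> complex) \<Rightarrow> (complex \<Rightarrow> complex) \<Rightarrow> complex \<Rightarrow> complex" where
  "weighted_comp_op \<psi> \<phi> f = (\<lambda>z. if z \<in> unit_disk then \<psi> z * f (\<phi> z) else 0)"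

definition bounded_operator ::
  "(nat \<Rightarrow> real) \<Rightarrow> ((complex \<Rightarrow> complex) \<Rightarrow> (complex \<Rightarrow> complex)) \<Rightarrow> bool" where
  "bounded_operator \<beta> T \<longleftrightarrow>
     (\<forall>f\<in>hardy_space \<beta>. T f \<in> hardy_space \<beta>) \<and>
     (\<forall>f\<in>hardy_space \<beta>. \<forall>g\<in>hardy_space \<beta>. T (\<lambda>z. f z + g z) = (\<lambda>z. T f z + T g z)) \<and>
     (\<forall>c. \<forall>f\<in>hardy_space \<beta>. T (\<lambda>z. c * f z) = (\<lambda>z. c * T f z)) \<and>
     (\<exists>C. \<forall>f\<in>hardy_space \<beta>. hardy_norm \<beta> (T f) \<le> C * hardy_norm \<beta> f)"

definition invertible_operator ::
  "(nat \<Rightarrow> real) \<Rightarrow> ((complex \<Rightarrow> complex) \<Rightarrow> (complex \<Rightarrow> complex)) \<Rightarrow> bool" where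
  "invertible_operator \<beta> T \<longleftrightarrow>
     (\<exists>S. bounded_operator \<beta> S \<and> (\<forall>f\<in>hardy_space \<beta>. S (T f) = f \<and> T (S f) = f))"

definition disk_automorphism :: "(complex \<Rightarrow> complex) \<Rightarrow> bool" where
  "disk_automorphism \<phi> \<longleftrightarrow>
     \<phi> holomorphic_on unit_disk \<and> bij_betw \<phi> unit_disk unit_disk"

end

theory Submission imports Defs begin

text \<open>
  Let \<open>R = liminf \<beta>(j)\<^sup>1\<^sup>/\<^sup>j \<ge> 1\<close>. Each element of the space is given by a power series
  that converges on the disk \<open>\<Omega>\<close> of radius \<open>R\<close> (the whole plane if \<open>R = \<infinity>\<close>), and evaluation at a
  point of \<open>\<Omega>\<close> is a bounded functional. The proof transports the operator \<open>W f = \<psi> \<cdot> (f \<circ> \<phi>)\<close> from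
  the unit disk to \<open>\<Omega>\<close> and shows that \<open>\<phi>\<close> extends to an automorphism of \<open>\<Omega>\<close>.

  The transport uses only that the functions \<open>W z\<^sup>n = \<psi> \<phi>\<^sup>n\<close> satisfy
  \<open>W z\<^sup>m \<cdot> W z\<^sup>n = W z\<^sup>m\<^sup>+\<^sup>n \<cdot> W 1\<close>, which persists on \<open>\<Omega>\<close> by analytic continuation. If \<open>W 1\<close>
  vanished at a point of \<open>\<Omega>\<close>, then so would every \<open>W z\<^sup>n\<close>, hence, by density of the polynomials,
  every function in the range of \<open>W\<close>; but \<open>W\<close> is surjective. So \<open>\<Theta> = W z / W 1\<close> is holomorphic on
  \<open>\<Omega>\<close> and extends \<open>\<phi>\<close>. Bounded evaluation gives \<open>|\<Theta>(w)|\<^sup>n \<le> const \<cdot> \<beta>(n)\<close>, so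
  \<open>|\<Theta>(w)| \<le> R\<close>, and \<open>\<Theta>\<close> maps \<open>\<Omega>\<close> into itself by the open mapping theorem. The inverse of \<open>W\<close>
  inherits the multiplicative identity (\<open>inverse_multiplicative\<close>), so it also has a symbol,
  and the two symbols are inverse to each other (\<open>symbol_symbol\<close>).

  If \<open>R = 1\<close>, this says that \<open>\<phi>\<close> is an automorphism of the unit disk. If \<open>R > 1\<close>, then \<open>\<Theta>\<close> is an
  automorphism of a larger disk or of the plane that maps the unit disk into itself, and
  \<open>symbol_rotation\<close> shows that it is a rotation. For finite \<open>R\<close> this is geometry: a disk automorphism
  that does not fix the centre pushes some point of every concentric smaller disk out of that disk.
  For \<open>R = \<infinity>\<close>, \<open>\<Theta>\<close> is affine, and the geometry leaves room for contractions \<open>z \<mapsto> az + b\<close> with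
  \<open>|a| < 1\<close>. These are excluded by the operator: its inverse would have the expanding symbol with
  derivative \<open>1/a\<close> at the fixed point \<open>p\<close>, and on functions vanishing to order \<open>n\<close> at \<open>p\<close> it would
  multiply the leading Taylor coefficient by \<open>const \<cdot> a\<^sup>-\<^sup>n\<close>, which is unbounded in \<open>n\<close>
  (\<open>affine_symbol_not_expanding\<close>).
\<close>

section \<open>Holomorphic automorphisms of disks and of the plane\<close>

text \<open>
  By the Schwarz lemma an automorphism has the form \<open>z \<mapsto> (\<zeta>z + b) / (1 + cnj b \<zeta>z)\<close>. In the
  direction in which \<open>\<zeta>z\<close> and \<open>b\<close> are aligned, its modulus at \<open>|z| = t\<close> is
  \<open>(t + |b|) / (1 + t|b|)\<close>, which exceeds \<open>t\<close> unless \<open>b = 0\<close>.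
\<close>

lemma disk_automorphism_preserving_smaller_disk:
  fixes f g :: "complex \<Rightarrow> complex" and t :: real
  assumes f: "f holomorphic_on ball 0 1" "f ` ball 0 1 \<subseteq> ball 0 1"
    and g: "g holomorphic_on ball 0 1" "g ` ball 0 1 \<subseteq> ball 0 1"
    and gf: "\<And>z. z \<in> ball 0 1 \<Longrightarrow> g (f z) = z"
    and fg: "\<And>z. z \<in> ball 0 1 \<Longrightarrow> f (g z) = z"
    and t: "0 < t" "t < 1" "f ` ball 0 t \<subseteq> cball 0 t"
  shows "\<exists>\<zeta>. cmod \<zeta> = 1 \<and> (\<forall>z\<in>ball 0 1. f z = \<zeta> * z)"
proof -
  define b where "b = f 0"
  have b: "cmod b < 1" using f(2) by (auto simp: b_def image_subset_iff)
  define h where "h = Moebius_function 0 b \<circ> f"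
  define k where "k = g \<circ> Moebius_function 0 (- b)"
  have h1: "cmod (h z) < 1" if "cmod z < 1" for z
    using f(2) that b Moebius_function_norm_lt_1[of b "f z" 0] by (auto simp: h_def image_subset_iff)
  have k1: "cmod (k z) < 1" if "cmod z < 1" for z
    using g(2) that b Moebius_function_norm_lt_1[of "-b" z 0] by (auto simp: k_def image_subset_iff)
  have hhol: "h holomorphic_on ball 0 1" unfolding h_def
    by (rule holomorphic_on_compose_gen[OF f(1) Moebius_function_holomorphic[OF b] f(2)])
  have khol: "k holomorphic_on ball 0 1" unfolding k_def
  proof (rule holomorphic_on_compose_gen[OF Moebius_function_holomorphic g(1)])
    show "Moebius_function 0 (- b) ` ball 0 1 \<subseteq> ball 0 1"
      using b Moebius_function_norm_lt_1[of "-b" _ 0] by auto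
  qed (use b in auto)
  have kh: "k (h z) = z" if "cmod z < 1" for z
    using that b f(2) gf[of z] Moebius_function_compose[of "-b" b "f z"]
    by (auto simp: k_def h_def image_subset_iff)
  have h0: "h 0 = 0" by (simp add: h_def b_def Moebius_function_eq_zero)
  have k0: "k 0 = 0" using kh[of 0] h0 by simp
  \<comment> \<open>The Schwarz lemma for \<open>h\<close> and for its inverse \<open>k\<close> forces equality at any nonzero point.\<close>
  define w where "w = complex_of_real (1/2)"
  have w: "cmod w < 1" "w \<noteq> 0" by (auto simp: w_def)
  have "cmod (h w) \<le> cmod w"
    using Schwarz_Lemma'[OF hhol h0 h1] w by blast
  moreover have "cmod (k (h w)) \<le> cmod (h w)"
    using Schwarz_Lemma'[OF khol k0 k1] h1 w by blast
  ultimately have "cmod (h w) = cmod w" using kh w by simp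
  then obtain \<zeta> where \<zeta>: "\<And>z. cmod z < 1 \<Longrightarrow> h z = \<zeta> * z" "cmod \<zeta> = 1"
    using Schwarz_Lemma'[OF hhol h0 h1] w by blast
  have fz: "f z = (\<zeta> * z + b) / (1 + cnj b * (\<zeta> * z))" if "cmod z < 1" for z
  proof -
    have "f z = Moebius_function 0 (- b) (h z)"
      using Moebius_function_compose[of "-b" b "f z"] that b f(2)
      by (auto simp: h_def image_subset_iff)
    then show ?thesis using \<zeta>(1)[OF that] by (simp add: Moebius_function_simple)
  qed
  have "b = 0"
  proof (rule ccontr)
    assume "b \<noteq> 0"
    \<comment> \<open>The unimodular direction in which \<open>\<zeta>u\<close> and \<open>b\<close> have the same argument.\<close>
    define u where "u = b / (\<zeta> * of_real (cmod b))"
    have "\<zeta> \<noteq> 0" using \<zeta>(2) by auto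
    have u: "cmod u = 1" "\<zeta> * u = b / of_real (cmod b)"
      using \<open>b \<noteq> 0\<close> \<zeta>(2) \<open>\<zeta> \<noteq> 0\<close> by (auto simp: u_def norm_divide norm_mult)
    have val: "cmod (f (of_real s * u)) = (s + cmod b) / (1 + cmod b * s)" if "0 \<le> s" "s < 1" for s
    proof -
      have "\<zeta> * (of_real s * u) = of_real s * b / of_real (cmod b)"
        using u(2) by (metis mult.left_commute times_divide_eq_right)
      then have "f (of_real s * u) = (of_real s * b / of_real (cmod b) + b) /
          (1 + cnj b * (of_real s * b / of_real (cmod b)))"
        using that u(1) by (simp add: fz norm_mult)
      also have "cnj b * (of_real s * b / of_real (cmod b)) = of_real (cmod b * s)"
      proof -
        have "cnj b * (of_real s * b / of_real (cmod b)) = of_real s * (b * cnj b) / of_real (cmod b)"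
          by simp
        also have "b * cnj b = of_real (cmod b) * of_real (cmod b)"
          using complex_norm_square[of b] by (simp add: power2_eq_square)
        finally show ?thesis using \<open>b \<noteq> 0\<close> by (simp add: mult_ac)
      qed
      also have "of_real s * b / of_real (cmod b) + b = (b / of_real (cmod b)) * of_real (s + cmod b)"
        using \<open>b \<noteq> 0\<close> by (simp add: field_simps)
      finally have "f (of_real s * u) =
          (b / of_real (cmod b)) * of_real ((s + cmod b) / (1 + cmod b * s))"
        by simp
      moreover have "cmod (b / of_real (cmod b)) = 1"
        using \<open>b \<noteq> 0\<close> by (simp add: norm_divide)
      ultimately have "cmod (f (of_real s * u)) = \<bar>(s + cmod b) / (1 + cmod b * s)\<bar>"
        by (simp only: norm_mult norm_of_real)
      then show ?thesis using that by simp
    qed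
    have "eventually (\<lambda>s. (s + cmod b) / (1 + cmod b * s) \<le> t) (at_left t)"
    proof -
      have "eventually (\<lambda>s. s \<in> {0<..<t}) (at_left t)"
        using t by (intro eventually_at_leftI[of 0]) auto
      then show ?thesis
      proof eventually_elim
        case (elim s)
        then have "cmod (f (of_real s * u)) \<le> t"
          using t(3) u(1) by (auto simp: image_subset_iff norm_mult)
        then show ?case using val[of s] elim t by simp
      qed
    qed
    moreover have "1 + cmod b * t \<noteq> 0"
      using t by (smt (verit) mult_nonneg_nonneg norm_ge_zero)
    then have "((\<lambda>s. (s + cmod b) / (1 + cmod b * s)) \<longlongrightarrow> (t + cmod b) / (1 + cmod b * t)) (at_left t)"
      by (intro tendsto_intros)
    ultimately have "(t + cmod b) / (1 + cmod b * t) \<le> t"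
      by (intro tendsto_upperbound) auto
    moreover have "1 + cmod b * t > 0" using t by (simp add: add_pos_nonneg)
    ultimately have "t + cmod b \<le> t + cmod b * t * t"
      by (simp add: field_simps)
    then have "cmod b * 1 \<le> cmod b * (t * t)" by simp
    then have "1 \<le> t * t" using \<open>b \<noteq> 0\<close> by (subst (asm) mult_le_cancel_left) auto
    moreover have "t * t < 1 * 1" using t by (intro mult_strict_mono) auto
    ultimately show False by simp
  qed
  then show ?thesis using fz \<zeta>(2) by auto
qed

text \<open>
  A homeomorphism of the plane is proper, and a proper entire function is a polynomial. Being
  injective, it has a derivative without zeros, so the derivative is constant.
\<close>

lemma entire_automorphism_affine:
  fixes f g :: "complex \<Rightarrow> complex"
  assumes f: "f holomorphic_on UNIV" and g: "continuous_on UNIV g"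
    and gf: "\<And>z. g (f z) = z" and fg: "\<And>z. f (g z) = z"
  shows "\<exists>a b. a \<noteq> 0 \<and> f = (\<lambda>z. a * z + b)"
proof -
  have "compact {z. f z \<in> K}" if "compact K" for K
  proof -
    have "z \<in> g ` K" if "f z \<in> K" for z
      using imageI[OF that, of g] gf[of z] by simp
    moreover have "f z \<in> K" if "z \<in> g ` K" for z
      using that fg by auto
    ultimately have "{z. f z \<in> K} = g ` K" by blast
    then show ?thesis
      using compact_continuous_image[OF continuous_on_subset[OF g] that] by simp
  qed
  then obtain c n where n: "f = (\<lambda>z. \<Sum>i\<le>n. c i * z ^ i)"
    using proper_map_polyfun_eq[OF f] by blast
  define p where "p = (\<Sum>i\<le>n. monom (c i) i)"
  have p: "f = poly p"
    by (auto simp: n p_def poly_sum poly_monom)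
  have inj: "inj f" using gf by (rule inj_on_inverseI)
  have nz: "poly (pderiv p) z \<noteq> 0" for z
    using holomorphic_injective_imp_regular[OF f open_UNIV inj UNIV_I, of z]
      DERIV_imp_deriv[OF poly_DERIV[of p z]] p by simp
  have "degree (pderiv p) = 0"
  proof (rule ccontr)
    assume "degree (pderiv p) \<noteq> 0"
    then have "\<exists>i\<in>{1..degree (pderiv p)}. coeff (pderiv p) i \<noteq> 0"
      by (intro bexI[of _ "degree (pderiv p)"]) auto
    then obtain z where "(\<Sum>i\<le>degree (pderiv p). coeff (pderiv p) i * z ^ i) = 0"
      using fundamental_theorem_of_algebra[of "coeff (pderiv p)" "degree (pderiv p)"] by blast
    then show False using nz[of z] by (simp add: poly_altdef)
  qed
  then have "degree p \<le> 1" by (simp add: degree_pderiv)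
  then have pp: "p = [:coeff p 0, coeff p 1:]"
    by (intro poly_eqI) (auto simp: coeff_pCons coeff_eq_0 split: nat.splits)
  have "poly p z = coeff p 1 * z + coeff p 0" for z
    by (subst pp) (simp add: algebra_simps)
  then obtain a b where ab: "f = (\<lambda>z. a * z + b)"
    using that[of "coeff p 1" "coeff p 0"] by (simp add: p fun_eq_iff)
  have "a \<noteq> 0"
  proof
    assume "a = 0"
    then have "f 0 = f 1" by (simp add: ab)
    then show False using injD[OF inj] zero_neq_one by blast
  qed
  with ab show ?thesis by blast
qed

text \<open>
  The sharp bound is \<open>|a| + |b| \<le> 1\<close>. The weaker one comes from averaging the squared modulus over
  two antipodal points, and it suffices to force \<open>b = 0\<close> when \<open>|a| \<ge> 1\<close>.
\<close>

lemma affine_disk_self_map_bound: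
  fixes a b :: complex
  assumes "\<And>z. z \<in> unit_disk \<Longrightarrow> cmod (a * z + b) < 1"
  shows "(cmod a)\<^sup>2 + (cmod b)\<^sup>2 \<le> 1"
proof -
  have "(cmod a)\<^sup>2 * s\<^sup>2 + (cmod b)\<^sup>2 \<le> 1" if s: "0 < s" "s < 1" for s :: real
  proof -
    have "cmod (b + a * of_real s) < 1" "cmod (b - a * of_real s) < 1"
      using assms[of "of_real s"] assms[of "- of_real s"] s by (auto simp: add.commute)
    then have "(cmod (b + a * of_real s))\<^sup>2 + (cmod (b - a * of_real s))\<^sup>2 \<le> 1 + 1"
      by (intro add_mono power_le_one) auto
    also have "(cmod (b + a * of_real s))\<^sup>2 + (cmod (b - a * of_real s))\<^sup>2 =
        2 * ((cmod a)\<^sup>2 * s\<^sup>2 + (cmod b)\<^sup>2)"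
      unfolding cmod_power2 by (simp add: power2_eq_square algebra_simps)
    finally show ?thesis by simp
  qed
  then have "eventually (\<lambda>s. (cmod a)\<^sup>2 * s\<^sup>2 + (cmod b)\<^sup>2 \<le> 1) (at_left 1)"
    by (intro eventually_at_leftI[of 0]) auto
  moreover have "((\<lambda>s. (cmod a)\<^sup>2 * s\<^sup>2 + (cmod b)\<^sup>2) \<longlongrightarrow> (cmod a)\<^sup>2 * 1\<^sup>2 + (cmod b)\<^sup>2) (at_left 1)"
    by (intro tendsto_intros)
  ultimately have "(cmod a)\<^sup>2 * 1\<^sup>2 + (cmod b)\<^sup>2 \<le> 1"
    by (intro tendsto_upperbound) auto
  then show ?thesis by simp
qed

section \<open>Elements of a weighted Hardy space as power series\<close>

text \<open>
  Elements of the space are extended by zero off the unit disk, and so are the polynomials here.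
\<close>

definition disk_poly :: "complex poly \<Rightarrow> complex \<Rightarrow> complex" where
  "disk_poly p = (\<lambda>z. if z \<in> unit_disk then poly p z else 0)"

abbreviation monomial :: "nat \<Rightarrow> complex \<Rightarrow> complex" where
  "monomial n \<equiv> disk_poly (monom 1 n)"

text \<open>
  The sum of the Maclaurin series at every point where it converges, in particular outside the unit
  disk, where the function itself carries no information.
\<close>

definition extension :: "(complex \<Rightarrow> complex) \<Rightarrow> complex \<Rightarrow> complex" where
  "extension f = eval_fps (fps_expansion f 0)"

lemma maclaurin_coeff_eq_fps_nth: "maclaurin_coeff f j = fps_nth (fps_expansion f 0) j"
  by (simp add: maclaurin_coeff_def fps_expansion_def)

lemma maclaurin_coeff_add:
  assumes "f holomorphic_on unit_disk" "g holomorphic_on unit_disk"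
  shows "maclaurin_coeff (\<lambda>z. f z + g z) j = maclaurin_coeff f j + maclaurin_coeff g j"
  using higher_deriv_add[OF assms open_ball, of 0 j]
  by (simp add: maclaurin_coeff_def add_divide_distrib)

lemma maclaurin_coeff_cmult:
  assumes "f holomorphic_on unit_disk"
  shows "maclaurin_coeff (\<lambda>z. c * f z) j = c * maclaurin_coeff f j"
  using higher_deriv_cmult[OF assms _ open_ball, of 0 j c]
  by (simp add: maclaurin_coeff_def)

lemma extension_on_disk:
  assumes "f holomorphic_on unit_disk" "z \<in> unit_disk"
  shows "extension f z = f z"
  using eval_fps_expansion'[of f 0 1 z] assms
  by (simp add: extension_def one_ereal_def)

lemma disk_poly_holomorphic: "disk_poly p holomorphic_on unit_disk"
proof -
  have "poly p holomorphic_on unit_disk"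
    by (intro holomorphic_intros)
  then show ?thesis
    by (rule holomorphic_transform) (simp add: disk_poly_def)
qed

lemma fps_expansion_disk_poly: "fps_expansion (disk_poly p) 0 = fps_of_poly p"
proof (rule fps_expansion_eqI)
  have "eventually (\<lambda>z. z \<in> unit_disk) (nhds (0::complex))"
    by (intro eventually_nhds_in_open) auto
  then have "eventually (\<lambda>z. eval_fps (fps_of_poly p) z = disk_poly p z) (nhds 0)"
    by eventually_elim (simp add: disk_poly_def)
  then show "disk_poly p has_fps_expansion fps_of_poly p"
    by (simp add: has_fps_expansion_def)
qed

lemma maclaurin_coeff_disk_poly: "maclaurin_coeff (disk_poly p) j = coeff p j"
  by (simp add: maclaurin_coeff_eq_fps_nth fps_expansion_disk_poly)

lemma extension_disk_poly: "extension (disk_poly p) = poly p"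
  by (simp add: extension_def fps_expansion_disk_poly fun_eq_iff)

locale weighted_hardy =
  fixes \<beta> :: "nat \<Rightarrow> real"
  assumes weight: "hardy_weight \<beta>"
begin

text \<open>
  This is \<open>liminf \<beta>(j)\<^sup>1\<^sup>/\<^sup>j\<close> (see \<open>radius_eq_liminf\<close>), in the form that makes summability of
  \<open>|w|\<^sup>j / \<beta>(j)\<close> immediate.
\<close>

definition radius :: ereal where
  "radius = conv_radius (\<lambda>j. 1 / \<beta> j)"

definition domain :: "complex set" where
  "domain = eball 0 radius"

lemma weight_pos: "\<beta> j > 0"
  using weight by (simp add: hardy_weight_def)

lemma in_domain_iff: "w \<in> domain \<longleftrightarrow> ereal (cmod w) < radius"
  by (simp add: domain_def)

lemma open_domain: "open domain" and connected_domain: "connected domain"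
  by (auto simp: domain_def)

lemma hardy_spaceD:
  assumes "f \<in> hardy_space \<beta>"
  shows "f holomorphic_on unit_disk" "\<And>z. z \<notin> unit_disk \<Longrightarrow> f z = 0"
    "summable (\<lambda>j. (cmod (maclaurin_coeff f j))\<^sup>2 * (\<beta> j)\<^sup>2)"
  using assms by (auto simp: hardy_space_def)

lemma hardy_norm_eq:
  assumes "f \<in> hardy_space \<beta>"
  shows "hardy_norm \<beta> f = sqrt (\<Sum>j. (cmod (maclaurin_coeff f j))\<^sup>2 * (\<beta> j)\<^sup>2)"
proof -
  have "hardy_inner \<beta> f f =
      (\<Sum>j. complex_of_real ((cmod (maclaurin_coeff f j))\<^sup>2 * (\<beta> j)\<^sup>2))"
    unfolding hardy_inner_def by (simp only: complex_norm_square of_real_mult)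
  also have "\<dots> = of_real (\<Sum>j. (cmod (maclaurin_coeff f j))\<^sup>2 * (\<beta> j)\<^sup>2)"
    by (rule suminf_of_real[symmetric, OF hardy_spaceD(3)[OF assms]])
  finally show ?thesis
    by (simp add: hardy_norm_def)
qed

lemma hardy_norm_nonneg: "f \<in> hardy_space \<beta> \<Longrightarrow> hardy_norm \<beta> f \<ge> 0"
  by (simp add: hardy_norm_eq suminf_nonneg hardy_spaceD(3))

lemma maclaurin_coeff_bound:
  assumes "f \<in> hardy_space \<beta>"
  shows "cmod (maclaurin_coeff f j) \<le> hardy_norm \<beta> f / \<beta> j"
proof -
  have "(cmod (maclaurin_coeff f j) * \<beta> j)\<^sup>2
      = (\<Sum>i\<in>{j}. (cmod (maclaurin_coeff f i))\<^sup>2 * (\<beta> i)\<^sup>2)"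
    by (simp add: power_mult_distrib)
  also have "\<dots> \<le> (\<Sum>i. (cmod (maclaurin_coeff f i))\<^sup>2 * (\<beta> i)\<^sup>2)"
    by (rule sum_le_suminf[OF hardy_spaceD(3)[OF assms]]) auto
  finally have "cmod (maclaurin_coeff f j) * \<beta> j \<le> hardy_norm \<beta> f"
    using weight_pos[of j] by (simp add: hardy_norm_eq[OF assms] real_le_rsqrt)
  then show ?thesis
    using weight_pos[of j] by (simp add: field_simps)
qed

lemma summable_kernel:
  assumes "ereal r < radius" "r \<ge> 0"
  shows "summable (\<lambda>j. r ^ j / \<beta> j)"
  using summable_in_conv_radius[of r "\<lambda>j. 1 / \<beta> j"] assms
  by (simp add: radius_def)

text \<open>
  Growth of the weights at least like \<open>r\<^sup>n\<close> makes the kernel series converge on the open disk of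
  radius \<open>r\<close>. With \<open>r\<close> the modulus of a symbol value, this confines the symbol to the closed disk.
\<close>

lemma radius_geI:
  assumes "\<And>n. r ^ n \<le> K * \<beta> n" "r \<ge> 0"
  shows "ereal r \<le> radius"
  unfolding radius_def
proof (rule conv_radius_geI_ex')
  fix s :: real assume s: "0 < s" "ereal s < ereal r"
  have "summable (\<lambda>n. K * (s / r) ^ n)"
    using s by (intro summable_mult summable_geometric) auto
  then show "summable (\<lambda>n. 1 / \<beta> n * of_real s ^ n)"
  proof (rule summable_comparison_test'[of _ 0])
    fix n :: nat
    have "s ^ n * r ^ n \<le> s ^ n * (K * \<beta> n)"
      using s assms(1)[of n] by (intro mult_left_mono) auto
    then show "norm (1 / \<beta> n * of_real s ^ n) \<le> K * (s / r) ^ n"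
      using s weight_pos[of n] by (simp add: field_simps power_divide)
  qed
qed

lemma conv_radius_hardy:
  assumes "f \<in> hardy_space \<beta>"
  shows "fps_conv_radius (fps_expansion f 0) \<ge> radius"
  unfolding fps_conv_radius_def
proof (rule conv_radius_geI_ex')
  fix r :: real assume r: "0 < r" "ereal r < radius"
  have "summable (\<lambda>j. hardy_norm \<beta> f * (r ^ j / \<beta> j))"
    using summable_kernel r by (intro summable_mult) auto
  then show "summable (\<lambda>n. fps_nth (fps_expansion f 0) n * of_real r ^ n)"
  proof (rule summable_comparison_test'[of _ 0])
    fix n :: nat
    show "norm (fps_nth (fps_expansion f 0) n * of_real r ^ n) \<le> hardy_norm \<beta> f * (r ^ n / \<beta> n)"
      using mult_right_mono[OF maclaurin_coeff_bound[OF assms, of n], of "r ^ n"] r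
      by (simp add: maclaurin_coeff_eq_fps_nth norm_mult norm_power)
  qed
qed

lemma extension_holomorphic:
  assumes "f \<in> hardy_space \<beta>"
  shows "extension f holomorphic_on domain"
  unfolding extension_def domain_def
  by (intro holomorphic_on_eval_fps eball_mono conv_radius_hardy assms)

text \<open>
  Each Maclaurin coefficient is at most \<open>\<parallel>f\<parallel> / \<beta>(j)\<close>, so the series is dominated termwise. The
  bound depends only on \<open>r\<close>, so it is uniform on smaller disks.
\<close>

lemma extension_bound:
  assumes "f \<in> hardy_space \<beta>" "cmod w \<le> r" "ereal r < radius"
  shows "cmod (extension f w) \<le> (\<Sum>j. r ^ j / \<beta> j) * hardy_norm \<beta> f"
proof -
  have r: "r \<ge> 0"
    using assms(2) norm_ge_zero order_trans by blast
  have S: "summable (\<lambda>j. hardy_norm \<beta> f * (r ^ j / \<beta> j))"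
    using summable_kernel[OF assms(3) r] by (intro summable_mult) auto
  have bound: "norm (fps_nth (fps_expansion f 0) j * w ^ j) \<le> hardy_norm \<beta> f * (r ^ j / \<beta> j)" for j
  proof -
    have "norm (fps_nth (fps_expansion f 0) j * w ^ j) \<le> hardy_norm \<beta> f / \<beta> j * r ^ j"
      unfolding norm_mult norm_power
      using maclaurin_coeff_bound[OF assms(1), of j] assms(2) hardy_norm_nonneg[OF assms(1)]
        weight_pos[of j]
      by (intro mult_mono power_mono) (auto simp: maclaurin_coeff_eq_fps_nth)
    then show ?thesis by simp
  qed
  have "cmod (extension f w) \<le> (\<Sum>j. hardy_norm \<beta> f * (r ^ j / \<beta> j))"
    unfolding extension_def eval_fps_def by (rule norm_suminf_le[OF bound S])
  also have "\<dots> = (\<Sum>j. r ^ j / \<beta> j) * hardy_norm \<beta> f"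
    unfolding suminf_mult[OF summable_kernel[OF assms(3) r]] by (rule mult.commute)
  finally show ?thesis .
qed

lemma hardy_space_add:
  assumes "f \<in> hardy_space \<beta>" "g \<in> hardy_space \<beta>"
  shows "(\<lambda>z. f z + g z) \<in> hardy_space \<beta>"
proof -
  have "summable (\<lambda>j. 2 * ((cmod (maclaurin_coeff f j))\<^sup>2 * (\<beta> j)\<^sup>2) +
                      2 * ((cmod (maclaurin_coeff g j))\<^sup>2 * (\<beta> j)\<^sup>2))"
    by (intro summable_add summable_mult hardy_spaceD assms)
  then have "summable (\<lambda>j. (cmod (maclaurin_coeff f j + maclaurin_coeff g j))\<^sup>2 * (\<beta> j)\<^sup>2)"
  proof (rule summable_comparison_test'[of _ 0])
    fix j :: nat
    define a b where "a = maclaurin_coeff f j" and "b = maclaurin_coeff g j"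
    have "(cmod (a + b))\<^sup>2 \<le> (cmod a + cmod b)\<^sup>2"
      by (intro power_mono norm_triangle_ineq) auto
    also have "\<dots> \<le> 2 * (cmod a)\<^sup>2 + 2 * (cmod b)\<^sup>2"
      using sum_squares_bound[of "cmod a" "cmod b"] by (simp add: power2_sum)
    finally have "(cmod (a + b))\<^sup>2 * (\<beta> j)\<^sup>2 \<le> (2 * (cmod a)\<^sup>2 + 2 * (cmod b)\<^sup>2) * (\<beta> j)\<^sup>2"
      by (rule mult_right_mono) auto
    then show "norm ((cmod (maclaurin_coeff f j + maclaurin_coeff g j))\<^sup>2 * (\<beta> j)\<^sup>2) \<le>
        2 * ((cmod (maclaurin_coeff f j))\<^sup>2 * (\<beta> j)\<^sup>2) +
        2 * ((cmod (maclaurin_coeff g j))\<^sup>2 * (\<beta> j)\<^sup>2)"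
      by (simp add: a_def b_def algebra_simps)
  qed
  then show ?thesis
    using hardy_spaceD[OF assms(1)] hardy_spaceD[OF assms(2)]
    by (auto simp: hardy_space_def maclaurin_coeff_add intro!: holomorphic_intros)
qed

lemma hardy_space_cmult:
  assumes "f \<in> hardy_space \<beta>"
  shows "(\<lambda>z. c * f z) \<in> hardy_space \<beta>"
proof -
  have "summable (\<lambda>j. (cmod c)\<^sup>2 * ((cmod (maclaurin_coeff f j))\<^sup>2 * (\<beta> j)\<^sup>2))"
    by (intro summable_mult hardy_spaceD assms)
  then have "summable (\<lambda>j. (cmod (c * maclaurin_coeff f j))\<^sup>2 * (\<beta> j)\<^sup>2)"
    by (simp add: norm_mult power_mult_distrib mult_ac)
  then show ?thesis
    using hardy_spaceD[OF assms]
    by (auto simp: hardy_space_def maclaurin_coeff_cmult intro!: holomorphic_intros)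
qed

lemma disk_poly_in_hardy_space: "disk_poly p \<in> hardy_space \<beta>"
proof -
  have "summable (\<lambda>j. (cmod (coeff p j))\<^sup>2 * (\<beta> j)\<^sup>2)"
    by (rule summable_finite[of "{..degree p}"]) (auto intro: coeff_eq_0)
  then show ?thesis
    using disk_poly_holomorphic[of p]
    by (simp add: hardy_space_def maclaurin_coeff_disk_poly) (simp add: disk_poly_def)
qed

lemma hardy_norm_monomial: "hardy_norm \<beta> (monomial n) = \<beta> n"
proof -
  have "(\<lambda>j. (cmod (maclaurin_coeff (monomial n) j))\<^sup>2 * (\<beta> j)\<^sup>2) = (\<lambda>j. if j = n then (\<beta> n)\<^sup>2 else 0)"
    by (auto simp: maclaurin_coeff_disk_poly)
  then show ?thesis
    using weight_pos[of n] sums_single[of n "\<lambda>_. (\<beta> n)\<^sup>2"]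
    by (simp add: hardy_norm_eq[OF disk_poly_in_hardy_space] sums_iff)
qed

text \<open>
  The sequence \<open>1 / ((j + 1) \<beta>(j))\<close> lies in the weighted \<open>\<ell>\<^sup>2\<close> space, so it consists of the
  coefficients of a function \<open>f\<close> holomorphic on the unit disk. The derivative of \<open>z f(z)\<close> has the
  coefficients \<open>1 / \<beta>(j)\<close>, and its series converges there as well.
\<close>

lemma radius_ge_1: "radius \<ge> 1"
proof -
  define a where "a j = complex_of_real (1 / (real (Suc j) * \<beta> j))" for j
  have "summable (\<lambda>j. inverse (real (Suc j) ^ 2))"
    using inverse_power_summable[of 2, where ?'a = real] by (subst summable_Suc_iff) auto
  moreover have "(cmod (a j))\<^sup>2 * (\<beta> j)\<^sup>2 = inverse (real (Suc j) ^ 2)" for j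
    using weight_pos[of j]
    by (simp add: a_def norm_divide norm_mult power_mult_distrib power_divide field_simps
        del: of_nat_Suc)
  ultimately have "summable (\<lambda>j. (cmod (a j))\<^sup>2 * (\<beta> j)\<^sup>2)"
    by simp
  then obtain f where f: "f \<in> hardy_space \<beta>" "\<And>j. maclaurin_coeff f j = a j"
    using weight unfolding hardy_weight_def by blast
  define F where "F = fps_expansion f 0"
  have "1 \<le> fps_conv_radius F"
    using conv_radius_fps_expansion[of f 0 1] hardy_spaceD(1)[OF f(1)]
    by (simp add: F_def one_ereal_def)
  also have "fps_conv_radius F \<le> fps_conv_radius (fps_X * F)"
    using fps_conv_radius_mult[of fps_X F] by simp
  also have "\<dots> \<le> fps_conv_radius (fps_deriv (fps_X * F))"
    by (rule fps_conv_radius_deriv)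
  also have "fps_nth (fps_deriv (fps_X * F)) j = of_real (1 / \<beta> j)" for j
  proof -
    have "fps_nth (fps_deriv (fps_X * F)) j = of_nat (Suc j) * fps_nth F j"
      by (simp add: fps_deriv_nth del: fps_deriv_mult of_nat_Suc)
    then show ?thesis
      using f(2)[of j] by (simp add: F_def maclaurin_coeff_eq_fps_nth a_def del: of_nat_Suc)
  qed
  then have "fps_conv_radius (fps_deriv (fps_X * F)) = radius"
    unfolding fps_conv_radius_def radius_def
    by (subst conv_radius_norm[symmetric], subst (2) conv_radius_norm[symmetric])
       (simp add: norm_divide)
  finally show ?thesis .
qed

lemma unit_disk_subset_domain: "unit_disk \<subseteq> domain"
  using radius_ge_1 ball_eball_mono[of 1 radius 0] by (simp add: domain_def one_ereal_def)

lemma radius_eq_liminf: "radius = liminf (\<lambda>j. ereal (root j (\<beta> j)))"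
proof -
  have "inverse (ereal (root n (norm (1 / \<beta> n)))) = ereal (root n (\<beta> n))" if "n > 0" for n
  proof -
    have "root n (norm (1 / \<beta> n)) = inverse (root n (\<beta> n))"
      using weight_pos[of n] that by (simp add: real_root_divide real_root_inverse divide_inverse)
    moreover have "root n (\<beta> n) > 0"
      using weight_pos[of n] that by simp
    ultimately show ?thesis by simp
  qed
  then have "\<forall>\<^sub>F n in sequentially. inverse (ereal (root n (norm (1 / \<beta> n)))) = ereal (root n (\<beta> n))"
    by (intro eventually_mono[OF eventually_gt_at_top[of 0]])
  then show ?thesis
    unfolding radius_def conv_radius_altdef by (rule Liminf_eq)
qed

lemma extension_add:
  assumes "f \<in> hardy_space \<beta>" "g \<in> hardy_space \<beta>" "w \<in> domain"
  shows "extension (\<lambda>z. f z + g z) w = extension f w + extension g w"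
proof -
  have "fps_expansion (\<lambda>z. f z + g z) 0 = fps_expansion f 0 + fps_expansion g 0"
    using assms by (intro fps_ext)
      (simp add: maclaurin_coeff_add hardy_spaceD(1) flip: maclaurin_coeff_eq_fps_nth)
  moreover have "ereal (cmod w) < fps_conv_radius (fps_expansion f 0)"
    "ereal (cmod w) < fps_conv_radius (fps_expansion g 0)"
    using assms conv_radius_hardy by (auto simp: in_domain_iff intro: less_le_trans)
  ultimately show ?thesis
    by (simp add: extension_def eval_fps_add)
qed

lemma extension_cmult:
  assumes "f \<in> hardy_space \<beta>" "w \<in> domain"
  shows "extension (\<lambda>z. c * f z) w = c * extension f w"
proof -
  have "ereal (cmod w) < fps_conv_radius (fps_expansion f 0)"
    using assms conv_radius_hardy by (auto simp: in_domain_iff intro: less_le_trans)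
  then have "(\<lambda>j. c * (maclaurin_coeff f j * w ^ j)) sums (c * extension f w)"
    unfolding extension_def maclaurin_coeff_eq_fps_nth by (intro sums_mult sums_eval_fps)
  then show ?thesis
    using hardy_spaceD(1)[OF assms(1)]
    by (simp add: extension_def eval_fps_def maclaurin_coeff_cmult mult_ac sums_iff
        flip: maclaurin_coeff_eq_fps_nth)
qed

text \<open>
  This is density of the polynomials: removing finitely many terms from the series of \<open>f\<close> does not
  change \<open>\<Phi> f\<close>, and it makes the norm arbitrarily small.
\<close>

lemma bounded_functional_zero_if_zero_on_monomials:
  fixes \<Phi> :: "(complex \<Rightarrow> complex) \<Rightarrow> complex"
  assumes add: "\<And>f g. f \<in> hardy_space \<beta> \<Longrightarrow> g \<in> hardy_space \<beta> \<Longrightarrow>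
                  \<Phi> (\<lambda>z. f z + g z) = \<Phi> f + \<Phi> g"
    and cmult: "\<And>c f. f \<in> hardy_space \<beta> \<Longrightarrow> \<Phi> (\<lambda>z. c * f z) = c * \<Phi> f"
    and bound: "\<And>f. f \<in> hardy_space \<beta> \<Longrightarrow> cmod (\<Phi> f) \<le> K * hardy_norm \<beta> f"
    and zero: "\<And>n. \<Phi> (monomial n) = 0"
    and f: "f \<in> hardy_space \<beta>"
  shows "\<Phi> f = 0"
proof -
  define c where "c = maclaurin_coeff f"
  define t where "t j = (cmod (c j))\<^sup>2 * (\<beta> j)\<^sup>2" for j
  have t: "summable t"
    using hardy_spaceD(3)[OF f] by (simp add: t_def[abs_def] c_def)
  have tail: "\<exists>r\<in>hardy_space \<beta>. (\<forall>j. maclaurin_coeff r j = (if j < N then 0 else c j)) \<and> \<Phi> r = \<Phi> f"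
    for N
  proof (induction N)
    case 0
    then show ?case using f by (auto simp: c_def)
  next
    case (Suc N)
    then obtain r where r: "r \<in> hardy_space \<beta>" "\<And>j. maclaurin_coeff r j = (if j < N then 0 else c j)"
      "\<Phi> r = \<Phi> f" by blast
    define m where "m = (\<lambda>z. - c N * monomial N z)"
    have m: "m \<in> hardy_space \<beta>"
      unfolding m_def by (intro hardy_space_cmult disk_poly_in_hardy_space)
    have mc: "maclaurin_coeff m j = (if j = N then - c N else 0)" for j
      unfolding m_def by (subst maclaurin_coeff_cmult) (auto simp: disk_poly_holomorphic maclaurin_coeff_disk_poly)
    have "maclaurin_coeff (\<lambda>z. r z + m z) j = (if j < Suc N then 0 else c j)" for j
      using r m by (subst maclaurin_coeff_add) (auto simp: mc hardy_spaceD(1))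
    moreover have "\<Phi> (\<lambda>z. r z + m z) = \<Phi> f"
      using r(3) cmult[OF disk_poly_in_hardy_space, of "- c N" "monom 1 N"] zero[of N] add[OF r(1) m]
      by (simp add: m_def)
    ultimately show ?case
      using hardy_space_add[OF r(1) m] by blast
  qed
  have "(cmod (\<Phi> f))\<^sup>2 \<le> \<epsilon>" if "\<epsilon> > 0" for \<epsilon>
  proof -
    have "\<epsilon> / (K\<^sup>2 + 1) > 0"
      using that by (intro divide_pos_pos) (auto simp: add_nonneg_pos)
    then obtain N where N: "norm (\<Sum>i. t (i + N)) < \<epsilon> / (K\<^sup>2 + 1)"
      using suminf_exist_split[OF _ t] by blast
    obtain r where r: "r \<in> hardy_space \<beta>" "\<And>j. maclaurin_coeff r j = (if j < N then 0 else c j)"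
      "\<Phi> r = \<Phi> f" using tail by blast
    have "(\<Sum>j. (cmod (maclaurin_coeff r j))\<^sup>2 * (\<beta> j)\<^sup>2) = (\<Sum>i. t (i + N))"
      by (subst suminf_split_initial_segment[OF hardy_spaceD(3)[OF r(1)], of N])
         (simp add: r(2) t_def)
    then have "(hardy_norm \<beta> r)\<^sup>2 = (\<Sum>i. t (i + N))"
      using hardy_norm_nonneg[OF r(1)] by (simp add: hardy_norm_eq[OF r(1)] t_def suminf_nonneg)
    then have norm: "(hardy_norm \<beta> r)\<^sup>2 \<le> \<epsilon> / (K\<^sup>2 + 1)"
      using N by simp
    have "(cmod (\<Phi> f))\<^sup>2 \<le> (K * hardy_norm \<beta> r)\<^sup>2"
      using bound[OF r(1)] r(3) by (intro power_mono) auto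
    also have "\<dots> \<le> K\<^sup>2 * (\<epsilon> / (K\<^sup>2 + 1))"
      using norm unfolding power_mult_distrib by (intro mult_left_mono) auto
    also have "\<dots> \<le> \<epsilon>"
    proof -
      have "K\<^sup>2 / (K\<^sup>2 + 1) \<le> 1"
        by (simp add: divide_le_eq add_nonneg_pos)
      then show ?thesis
        using mult_left_mono[of "K\<^sup>2 / (K\<^sup>2 + 1)" 1 \<epsilon>] that by (simp add: mult_ac)
    qed
    finally show ?thesis .
  qed
  then have "(cmod (\<Phi> f))\<^sup>2 \<le> 0"
    by (rule field_le_epsilon[of _ "0::real", simplified])
  then show ?thesis by simp
qed

end

section \<open>Isomorphisms that act multiplicatively on monomials\<close>

text \<open>
  For \<open>T f = \<psi> \<cdot> (f \<circ> \<phi>)\<close> these are the continuations of \<open>\<psi>\<close> and of \<open>\<phi>\<close> beyond the unit disk.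
\<close>

definition multiplier :: "((complex \<Rightarrow> complex) \<Rightarrow> complex \<Rightarrow> complex) \<Rightarrow> complex \<Rightarrow> complex" where
  "multiplier T = extension (T (monomial 0))"

definition symbol :: "((complex \<Rightarrow> complex) \<Rightarrow> complex \<Rightarrow> complex) \<Rightarrow> complex \<Rightarrow> complex" where
  "symbol T w = extension (T (monomial 1)) w / multiplier T w"

text \<open>
  A weighted composition operator satisfies the last condition, and, unlike the form
  \<open>\<psi> \<cdot> (f \<circ> \<phi>)\<close>, the condition makes sense for its inverse and is stable under analytic
  continuation. It is what makes the situation symmetric in \<open>T\<close> and \<open>S\<close>.
\<close>

locale multiplicative_isomorphism = weighted_hardy +
  fixes T S :: "(complex \<Rightarrow> complex) \<Rightarrow> complex \<Rightarrow> complex"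
  assumes bounded_T: "bounded_operator \<beta> T" and bounded_S: "bounded_operator \<beta> S"
    and ST: "\<And>f. f \<in> hardy_space \<beta> \<Longrightarrow> S (T f) = f"
    and TS: "\<And>f. f \<in> hardy_space \<beta> \<Longrightarrow> T (S f) = f"
    and multiplicative: "\<And>m n w. w \<in> domain \<Longrightarrow>
      extension (T (monomial m)) w * extension (T (monomial n)) w =
      extension (T (monomial (m + n))) w * extension (T (monomial 0)) w"
begin

lemma T_in: "f \<in> hardy_space \<beta> \<Longrightarrow> T f \<in> hardy_space \<beta>"
  and S_in: "f \<in> hardy_space \<beta> \<Longrightarrow> S f \<in> hardy_space \<beta>"
  using bounded_T bounded_S by (simp_all add: bounded_operator_def)

lemma T_add: "f \<in> hardy_space \<beta> \<Longrightarrow> g \<in> hardy_space \<beta> \<Longrightarrow> T (\<lambda>z. f z + g z) = (\<lambda>z. T f z + T g z)"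
  and T_cmult: "f \<in> hardy_space \<beta> \<Longrightarrow> T (\<lambda>z. c * f z) = (\<lambda>z. c * T f z)"
  using bounded_T by (simp_all add: bounded_operator_def)

lemma T_norm_bound:
  obtains C where "C > 0" "\<And>f. f \<in> hardy_space \<beta> \<Longrightarrow> hardy_norm \<beta> (T f) \<le> C * hardy_norm \<beta> f"
proof -
  obtain C where C: "\<And>f. f \<in> hardy_space \<beta> \<Longrightarrow> hardy_norm \<beta> (T f) \<le> C * hardy_norm \<beta> f"
    using bounded_T unfolding bounded_operator_def by blast
  have "hardy_norm \<beta> (T f) \<le> (\<bar>C\<bar> + 1) * hardy_norm \<beta> f" if "f \<in> hardy_space \<beta>" for f
    using C[OF that] hardy_norm_nonneg[OF that] mult_right_mono[of C "\<bar>C\<bar> + 1" "hardy_norm \<beta> f"]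
    by linarith
  then show ?thesis
    by (intro that[of "\<bar>C\<bar> + 1"]) auto
qed

text \<open>
  Both sides are bounded linear functionals of \<open>f\<close>, so it suffices that they agree on monomials.
\<close>

lemma extension_T_eqI:
  assumes w: "w \<in> domain" and v: "v \<in> domain" and f: "f \<in> hardy_space \<beta>"
    and mono: "\<And>n. extension (T (monomial n)) w = c * v ^ n"
  shows "extension (T f) w = c * extension f v"
proof -
  obtain C where C: "C > 0" "\<And>f. f \<in> hardy_space \<beta> \<Longrightarrow> hardy_norm \<beta> (T f) \<le> C * hardy_norm \<beta> f"
    by (rule T_norm_bound) blast
  define K where "K u = (\<Sum>j. cmod u ^ j / \<beta> j)" for u
  have K: "cmod (extension g u) \<le> K u * hardy_norm \<beta> g" if "g \<in> hardy_space \<beta>" "u \<in> domain" for g u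
    using extension_bound[of g u "cmod u"] that by (simp add: K_def in_domain_iff)
  have K0: "K w \<ge> 0"
    unfolding K_def using w weight_pos[THEN less_imp_le]
    by (intro suminf_nonneg summable_kernel) (auto simp: in_domain_iff)
  have "extension (T f) w + (- c) * extension f v = 0"
  proof (rule bounded_functional_zero_if_zero_on_monomials[of "\<lambda>f. extension (T f) w + (- c) * extension f v"
        "K w * C + cmod c * K v"])
    fix g assume g: "g \<in> hardy_space \<beta>"
    have "cmod (extension (T g) w) \<le> K w * (C * hardy_norm \<beta> g)"
      using K[OF T_in[OF g] w] mult_left_mono[OF C(2)[OF g] K0] by linarith
    moreover have "cmod (c * extension g v) \<le> cmod c * (K v * hardy_norm \<beta> g)"
      unfolding norm_mult using K[OF g v] by (intro mult_left_mono) auto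
    moreover have "cmod (extension (T g) w + (- c) * extension g v)
        \<le> cmod (extension (T g) w) + cmod (c * extension g v)"
      using norm_triangle_ineq4[of "extension (T g) w" "c * extension g v"] by simp
    ultimately show "cmod (extension (T g) w + (- c) * extension g v)
        \<le> (K w * C + cmod c * K v) * hardy_norm \<beta> g"
      by (simp add: algebra_simps)
  qed (use w v mono f in \<open>simp_all add: T_add T_cmult extension_add extension_cmult T_in
        extension_disk_poly poly_monom algebra_simps\<close>)
  then show ?thesis by simp
qed

text \<open>
  At a zero of \<open>T 1\<close> the identity \<open>(T z\<^sup>n)\<^sup>2 = T z\<^sup>2\<^sup>n \<cdot> T 1\<close> makes every \<open>T z\<^sup>n\<close> vanish, hence every
  function in the range of \<open>T\<close>. But \<open>1\<close> is in the range.
\<close>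

lemma multiplier_nonzero:
  assumes w: "w \<in> domain"
  shows "multiplier T w \<noteq> 0"
proof
  assume "multiplier T w = 0"
  then have "extension (T (monomial n)) w * extension (T (monomial n)) w = 0" for n
    using multiplicative[OF w, of n n] by (simp add: multiplier_def)
  then have "extension (T (monomial n)) w = 0 * 0 ^ n" for n
    by simp
  then have "extension (T (S (monomial 0))) w = 0 * extension (S (monomial 0)) 0"
    using unit_disk_subset_domain by (intro extension_T_eqI w S_in disk_poly_in_hardy_space) auto
  then show False
    by (simp add: TS disk_poly_in_hardy_space extension_disk_poly poly_monom)
qed

lemma extension_T_monomial:
  assumes "w \<in> domain"
  shows "extension (T (monomial n)) w = multiplier T w * symbol T w ^ n"
proof (induction n)
  case (Suc n)
  show ?case
    using multiplicative[OF assms, of n 1] multiplier_nonzero[OF assms]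
    by (simp add: Suc symbol_def multiplier_def field_simps)
qed (simp add: multiplier_def)

lemma multiplier_holomorphic: "multiplier T holomorphic_on domain"
  unfolding multiplier_def by (intro extension_holomorphic T_in disk_poly_in_hardy_space)

lemma symbol_holomorphic: "symbol T holomorphic_on domain"
  unfolding symbol_def[abs_def]
  by (intro holomorphic_intros extension_holomorphic multiplier_holomorphic T_in
      disk_poly_in_hardy_space multiplier_nonzero)

text \<open>
  Evaluation at \<open>w\<close> is bounded and \<open>\<parallel>z\<^sup>n\<parallel> = \<beta>(n)\<close>, so \<open>T z\<^sup>n = multiplier \<cdot> symbol\<^sup>n\<close> at \<open>w\<close> is
  at most a constant times \<open>\<beta>(n)\<close>.
\<close>

lemma norm_symbol_le_radius:
  assumes w: "w \<in> domain"
  shows "ereal (cmod (symbol T w)) \<le> radius"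
proof -
  obtain C where C: "C > 0" "\<And>f. f \<in> hardy_space \<beta> \<Longrightarrow> hardy_norm \<beta> (T f) \<le> C * hardy_norm \<beta> f"
    by (rule T_norm_bound) blast
  define K where "K = (\<Sum>j. cmod w ^ j / \<beta> j)"
  have K0: "K \<ge> 0"
    unfolding K_def using w weight_pos[THEN less_imp_le]
    by (intro suminf_nonneg summable_kernel) (auto simp: in_domain_iff)
  have "cmod (symbol T w) ^ n \<le> (K * C / cmod (multiplier T w)) * \<beta> n" for n
  proof -
    have "cmod (extension (T (monomial n)) w) \<le> K * hardy_norm \<beta> (T (monomial n))"
      using extension_bound[OF T_in[OF disk_poly_in_hardy_space], of w "cmod w"] w
      by (simp add: K_def in_domain_iff)
    also have "\<dots> \<le> K * (C * \<beta> n)"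
      using C(2)[OF disk_poly_in_hardy_space, of "monom 1 n"] K0
      by (intro mult_left_mono) (simp_all add: hardy_norm_monomial)
    finally show ?thesis
      using multiplier_nonzero[OF w]
      by (simp add: extension_T_monomial[OF w] norm_mult norm_power field_simps)
  qed
  then show ?thesis
    by (rule radius_geI) auto
qed

text \<open>
  If the symbol were the constant \<open>c\<close>, then \<open>T (z - c) = 0\<close>, against injectivity.
\<close>

lemma symbol_not_constant: "\<not> symbol T constant_on domain"
proof
  assume "symbol T constant_on domain"
  then obtain c where c: "\<And>w. w \<in> domain \<Longrightarrow> symbol T w = c"
    by (auto simp: constant_on_def)
  define g where "g = (\<lambda>z. monomial 1 z + (- c) * monomial 0 z)"
  have cm: "(\<lambda>z. (- c) * monomial 0 z) \<in> hardy_space \<beta>"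
    by (intro hardy_space_cmult disk_poly_in_hardy_space)
  have g: "g \<in> hardy_space \<beta>"
    unfolding g_def by (intro hardy_space_add cm disk_poly_in_hardy_space)
  have Tg: "T g = (\<lambda>z. T (monomial 1) z + (- c) * T (monomial 0) z)"
    unfolding g_def using T_add[OF disk_poly_in_hardy_space cm, of "monom 1 1"]
      T_cmult[OF disk_poly_in_hardy_space, of "- c" "monom 1 0"] by simp
  have "extension (T g) w = 0" if "w \<in> domain" for w
    unfolding Tg
    by (subst extension_add, simp_all only: T_in disk_poly_in_hardy_space hardy_space_cmult that
        extension_cmult extension_T_monomial[OF that] c[OF that]) simp
  then have "T g z = 0" if "z \<in> unit_disk" for z
    using that unit_disk_subset_domain extension_on_disk[OF hardy_spaceD(1)[OF T_in[OF g]] that]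
    by auto
  then have "T g = (\<lambda>z. 0 * monomial 0 z)"
    using hardy_spaceD(2)[OF T_in[OF g]] by (auto simp: fun_eq_iff)
  also have "\<dots> = T (\<lambda>z. 0 * monomial 0 z)"
    using T_cmult[OF disk_poly_in_hardy_space, of 0 "monom 1 0"] by simp
  finally have "S (T g) = S (T (\<lambda>z. 0 * monomial 0 z))" by simp
  then have "g = (\<lambda>z. 0 * monomial 0 z)"
    by (simp only: ST g hardy_space_cmult disk_poly_in_hardy_space)
  then have "g 0 = 0" "g (1/2) = 0" by simp_all
  then show False by (simp add: g_def disk_poly_def poly_monom)
qed

lemma symbol_in_domain:
  assumes w: "w \<in> domain"
  shows "symbol T w \<in> domain"
proof (cases radius)
  case (real r)
  have "open (symbol T ` domain)"
    by (rule open_mapping_thm[OF symbol_holomorphic open_domain connected_domain open_domain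
          order_refl symbol_not_constant])
  moreover have "symbol T ` domain \<subseteq> cball 0 r"
    using norm_symbol_le_radius real by auto
  ultimately have "symbol T ` domain \<subseteq> interior (cball 0 r)"
    by (intro interior_maximal)
  then show ?thesis
    using imageI[OF w, of "symbol T"] real by (auto simp: interior_cball domain_def)
next
  case PInf
  then show ?thesis by (simp add: domain_def)
next
  case MInf
  then show ?thesis using radius_ge_1 by simp
qed

lemma extension_T:
  assumes "w \<in> domain" "f \<in> hardy_space \<beta>"
  shows "extension (T f) w = multiplier T w * extension f (symbol T w)"
  by (rule extension_T_eqI[OF assms(1) symbol_in_domain[OF assms(1)] assms(2)
        extension_T_monomial[OF assms(1)]])

text \<open>
  Applying \<open>extension_T\<close> to \<open>S z\<^sup>k\<close> expresses it at \<open>symbol T v\<close> as \<open>v\<^sup>k / multiplier T v\<close>. So the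
  identity holds on the range of the symbol, which is open, and therefore on the whole domain.
\<close>

lemma inverse_multiplicative: "multiplicative_isomorphism \<beta> S T"
proof unfold_locales
  fix m n w assume w: "w \<in> domain"
  let ?G = "\<lambda>n. extension (S (monomial n))"
  have G: "?G n holomorphic_on domain" for n
    by (intro extension_holomorphic S_in disk_poly_in_hardy_space)
  show "?G m w * ?G n w = ?G (m + n) w * ?G 0 w"
  proof (rule analytic_continuation_open[of "symbol T ` domain" domain
        "\<lambda>w. ?G m w * ?G n w" "\<lambda>w. ?G (m + n) w * ?G 0 w"])
    show "open (symbol T ` domain)"
      by (rule open_mapping_thm[OF symbol_holomorphic open_domain connected_domain open_domain
          order_refl symbol_not_constant])
    fix u assume "u \<in> symbol T ` domain"
    then obtain v where v: "v \<in> domain" "u = symbol T v" by auto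
    have *: "multiplier T v * ?G k u = v ^ k" for k
      using extension_T[OF v(1) S_in[OF disk_poly_in_hardy_space], of "monom 1 k"]
      by (simp add: v(2) TS disk_poly_in_hardy_space extension_disk_poly poly_monom)
    have "(multiplier T v)\<^sup>2 * (?G m u * ?G n u) = (multiplier T v * ?G m u) * (multiplier T v * ?G n u)"
      by (simp add: power2_eq_square)
    also have "\<dots> = (multiplier T v * ?G (m + n) u) * (multiplier T v * ?G 0 u)"
      unfolding * by (simp add: power_add)
    also have "\<dots> = (multiplier T v)\<^sup>2 * (?G (m + n) u * ?G 0 u)"
      by (simp add: power2_eq_square)
    finally show "?G m u * ?G n u = ?G (m + n) u * ?G 0 u"
      using multiplier_nonzero[OF v(1)] by simp
  qed (use w symbol_in_domain open_domain connected_domain in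
      \<open>auto intro!: holomorphic_on_mult G simp del: monom_eq_1\<close>)
qed (use bounded_T bounded_S ST TS in auto)

lemma symbol_symbol:
  assumes w: "w \<in> domain"
  shows "symbol S (symbol T w) = w"
proof -
  interpret inv: multiplicative_isomorphism \<beta> S T by (rule inverse_multiplicative)
  have *: "multiplier T w * extension (S (monomial k)) (symbol T w) = w ^ k" for k
    using extension_T[OF w S_in[OF disk_poly_in_hardy_space], of "monom 1 k"]
    by (simp add: TS disk_poly_in_hardy_space extension_disk_poly poly_monom)
  have "symbol S (symbol T w) = (multiplier T w * extension (S (monomial 1)) (symbol T w)) /
      (multiplier T w * extension (S (monomial 0)) (symbol T w))"
    using multiplier_nonzero[OF w] by (simp add: symbol_def multiplier_def)
  then show ?thesis by (simp only: *) simp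
qed

text \<open>
  The iterate \<open>T\<^sup>k\<close> multiplies \<open>(z - p)\<^sup>n\<close> by \<open>c\<^sup>k\<^sup>n\<close> and by a product of \<open>k\<close> values of the multiplier,
  which at \<open>p\<close> equals \<open>(multiplier T p)\<^sup>k\<close>. Since \<open>\<parallel>T\<^sup>k\<parallel> \<le> C\<^sup>k\<close>, the maximum principle on the unit
  circle about \<open>p\<close> bounds \<open>(|multiplier T p| |c|\<^sup>n)\<^sup>k\<close> by a constant times \<open>C\<^sup>k\<close>. Letting
  \<open>k \<rightarrow> \<infinity>\<close> removes the constant, which depends on \<open>n\<close>, and leaves \<open>|multiplier T p| |c|\<^sup>n \<le> C\<close>.
  The left side is unbounded in \<open>n\<close> if \<open>|c| > 1\<close>.
\<close>

lemma affine_symbol_not_expanding: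
  assumes "radius = \<infinity>" "\<And>w. symbol T w = p + c * (w - p)"
  shows "cmod c \<le> 1"
proof (rule ccontr)
  assume "\<not> cmod c \<le> 1"
  then have c: "cmod c > 1" by simp
  have dom: "domain = UNIV" using assms(1) by (simp add: domain_def)
  obtain C where C: "C > 0" "\<And>f. f \<in> hardy_space \<beta> \<Longrightarrow> hardy_norm \<beta> (T f) \<le> C * hardy_norm \<beta> f"
    by (rule T_norm_bound) blast
  define F where "F = multiplier T"
  have F: "F holomorphic_on UNIV"
    using multiplier_holomorphic by (simp add: F_def dom)
  define K where "K = (\<Sum>j. (cmod p + 1) ^ j / \<beta> j)"
  have K0: "K \<ge> 0"
    unfolding K_def using weight_pos[THEN less_imp_le] assms(1)
    by (intro suminf_nonneg summable_kernel) auto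
  have main: "cmod (F p) * cmod c ^ n \<le> C" for n
  proof -
    define f where "f = disk_poly ([:- p, 1:] ^ n)"
    have f: "f \<in> hardy_space \<beta>" by (simp add: f_def disk_poly_in_hardy_space)
    define P where "P k w = (\<Prod>i<k. F (p + c ^ i * (w - p)))" for k w
    have iter: "(T ^^ k) f \<in> hardy_space \<beta> \<and> hardy_norm \<beta> ((T ^^ k) f) \<le> C ^ k * hardy_norm \<beta> f \<and>
       (\<forall>w. extension ((T ^^ k) f) w = P k w * (c ^ k * (w - p)) ^ n)" for k
    proof (induction k)
      case 0
      then show ?case using f by (simp add: P_def f_def extension_disk_poly poly_power)
    next
      case (Suc k)
      let ?g = "(T ^^ k) f"
      have g: "?g \<in> hardy_space \<beta>" using Suc by blast
      have "hardy_norm \<beta> (T ?g) \<le> C * (C ^ k * hardy_norm \<beta> f)"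
        using C(2)[OF g] Suc C(1) mult_left_mono[of "hardy_norm \<beta> ?g" "C ^ k * hardy_norm \<beta> f" C]
        by linarith
      moreover have "extension (T ?g) w = P (Suc k) w * (c ^ Suc k * (w - p)) ^ n" for w
      proof -
        have "P (Suc k) w = F w * P k (p + c * (w - p))"
          unfolding P_def by (subst prod.lessThan_Suc_shift) (simp add: mult_ac)
        then show ?thesis
          using extension_T[OF _ g, of w] Suc by (simp add: dom assms(2) F_def mult_ac)
      qed
      ultimately show ?case using T_in[OF g] by (simp add: mult_ac)
    qed
    have Fpk: "(cmod (F p) * cmod c ^ n) ^ k \<le> (K * hardy_norm \<beta> f) * C ^ k" for k
    proof -
      have cpos: "cmod c ^ (k * n) > 0" using c by (intro zero_less_power) linarith
      have hol: "P k holomorphic_on UNIV"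
      proof -
        have "(\<lambda>w. F (p + c ^ i * (w - p))) holomorphic_on UNIV" for i
          using holomorphic_on_compose_gen[of "\<lambda>w. p + c ^ i * (w - p)" UNIV F UNIV] F
          by (simp add: o_def holomorphic_intros)
        then show ?thesis unfolding P_def[abs_def] by (intro holomorphic_intros)
      qed
      have bd: "cmod (P k w) \<le> K * (C ^ k * hardy_norm \<beta> f) / cmod c ^ (k * n)" if "cmod (w - p) = 1" for w
      proof -
        have "cmod w \<le> cmod p + 1" using that norm_triangle_sub[of w p] by simp
        then have "cmod (extension ((T ^^ k) f) w) \<le> K * hardy_norm \<beta> ((T ^^ k) f)"
          using extension_bound[of "(T ^^ k) f" w "cmod p + 1"] iter[of k] assms(1)
          by (simp add: K_def)
        also have "\<dots> \<le> K * (C ^ k * hardy_norm \<beta> f)"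
          using iter[of k] K0 by (intro mult_left_mono) auto
        also have "cmod (extension ((T ^^ k) f) w) = cmod (P k w) * cmod c ^ (k * n)"
          using iter[of k] that by (simp add: norm_mult norm_power power_mult)
        finally show ?thesis using cpos by (simp only: pos_le_divide_eq)
      qed
      have "cmod (P k p) \<le> K * (C ^ k * hardy_norm \<beta> f) / cmod c ^ (k * n)"
      proof (rule maximum_modulus_frontier[of "P k" "cball p 1"])
        fix w assume "w \<in> frontier (cball p 1)"
        then show "cmod (P k w) \<le> K * (C ^ k * hardy_norm \<beta> f) / cmod c ^ (k * n)"
          by (intro bd) (auto simp: frontier_cball dist_norm norm_minus_commute)
      qed (use hol in \<open>auto intro: holomorphic_on_subset holomorphic_on_imp_continuous_on
             continuous_on_subset\<close>)
      moreover have "cmod (P k p) = cmod (F p) ^ k" by (simp add: P_def norm_power)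
      ultimately have "cmod (F p) ^ k * cmod c ^ (k * n) \<le> K * (C ^ k * hardy_norm \<beta> f)"
        using cpos by (simp only: pos_le_divide_eq)
      then show ?thesis
        by (simp add: power_mult_distrib power_mult[symmetric] mult_ac)
    qed
    show ?thesis
    proof (rule ccontr)
      define q where "q = cmod (F p) * cmod c ^ n / C"
      assume "\<not> cmod (F p) * cmod c ^ n \<le> C"
      then have "q > 1" using C(1) by (simp add: q_def field_simps)
      then obtain k where "K * hardy_norm \<beta> f < q ^ k" using real_arch_pow by blast
      moreover have "q ^ k \<le> K * hardy_norm \<beta> f"
        using Fpk[of k] C(1) by (simp add: q_def power_divide field_simps)
      ultimately show False by simp
    qed
  qed
  have "cmod (F p) > 0" using multiplier_nonzero[of p] by (simp add: F_def dom)
  obtain n where "C / cmod (F p) < cmod c ^ n" using real_arch_pow[OF c] by blast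
  then have "C < cmod (F p) * cmod c ^ n"
    using \<open>cmod (F p) > 0\<close> by (simp add: field_simps)
  then show False using main[of n] by simp
qed

text \<open>
  For finite radius \<open>r\<close>, rescaling by \<open>r\<close> turns the symbol into an automorphism of the unit disk that
  preserves the disk of radius \<open>1/r\<close>. For infinite radius the symbol is affine, and contractions are
  the case that only the operator can exclude.
\<close>

lemma symbol_rotation:
  assumes "radius > 1" and disk: "symbol T ` unit_disk \<subseteq> unit_disk"
  shows "\<exists>\<zeta>. cmod \<zeta> = 1 \<and> (\<forall>z\<in>unit_disk. symbol T z = \<zeta> * z)"
proof -
  interpret inv: multiplicative_isomorphism \<beta> S T by (rule inverse_multiplicative)
  let ?\<Theta> = "symbol T" and ?\<tau> = "symbol S"
  show ?thesis
  proof (cases radius)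
    case (real r)
    have r: "r > 1" using assms(1) real by simp
    have dom: "domain = ball 0 r" by (simp add: domain_def real)
    have scale: "(\<lambda>z. h (of_real r * z) / of_real r) holomorphic_on ball 0 1 \<and>
        (\<lambda>z. h (of_real r * z) / of_real r) ` ball 0 1 \<subseteq> ball 0 1"
      if h: "h holomorphic_on domain" "\<And>w. w \<in> domain \<Longrightarrow> h w \<in> domain" for h
    proof -
      have "(\<lambda>z. of_real r * z) ` ball 0 1 \<subseteq> domain"
        using r by (auto simp: dom norm_mult)
      then have "(h \<circ> (\<lambda>z. of_real r * z)) holomorphic_on ball 0 1"
        by (intro holomorphic_on_compose_gen[OF _ h(1)] holomorphic_intros)
      then show ?thesis
        using h(2) r by (auto simp: o_def dom norm_mult norm_divide intro!: holomorphic_intros)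
    qed
    define f where "f = (\<lambda>z. ?\<Theta> (of_real r * z) / of_real r)"
    define g where "g = (\<lambda>z. ?\<tau> (of_real r * z) / of_real r)"
    have "\<exists>\<zeta>. cmod \<zeta> = 1 \<and> (\<forall>z\<in>ball 0 1. f z = \<zeta> * z)"
    proof (rule disk_automorphism_preserving_smaller_disk[where g = g and t = "1 / r"])
      show "f holomorphic_on ball 0 1" "f ` ball 0 1 \<subseteq> ball 0 1"
        unfolding f_def using scale[OF symbol_holomorphic symbol_in_domain] by auto
      show "g holomorphic_on ball 0 1" "g ` ball 0 1 \<subseteq> ball 0 1"
        unfolding g_def using scale[OF inv.symbol_holomorphic inv.symbol_in_domain] by auto
      show "g (f z) = z" "f (g z) = z" if "z \<in> ball 0 1" for z
        using r that symbol_symbol[of "of_real r * z"] inv.symbol_symbol[of "of_real r * z"]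
        by (auto simp: f_def g_def dom norm_mult)
      show "0 < 1 / r" "1 / r < 1" using r by auto
      show "f ` ball 0 (1 / r) \<subseteq> cball 0 (1 / r)"
      proof (intro image_subsetI)
        fix z :: complex assume "z \<in> ball 0 (1 / r)"
        then have "of_real r * z \<in> unit_disk"
          using r by (simp add: norm_mult field_simps)
        then have "?\<Theta> (of_real r * z) \<in> unit_disk" using disk by blast
        then show "f z \<in> cball 0 (1 / r)"
          using r by (simp add: f_def norm_divide divide_simps)
      qed
    qed
    then obtain \<zeta> where \<zeta>: "cmod \<zeta> = 1" "\<And>z. z \<in> ball 0 1 \<Longrightarrow> f z = \<zeta> * z" by blast
    have "?\<Theta> z = \<zeta> * z" if "z \<in> unit_disk" for z
    proof -
      have "z / of_real r \<in> ball 0 1" using that r by (simp add: norm_divide)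
      then show ?thesis using \<zeta>(2)[of "z / of_real r"] r by (simp add: f_def)
    qed
    then show ?thesis using \<zeta>(1) by blast
  next
    case PInf
    have dom: "domain = UNIV" by (simp add: domain_def PInf)
    obtain a b where a: "a \<noteq> 0" and ab: "?\<Theta> = (\<lambda>z. a * z + b)"
      using entire_automorphism_affine[of ?\<Theta> ?\<tau>] symbol_holomorphic inv.symbol_holomorphic
        symbol_symbol inv.symbol_symbol
      by (auto simp: dom holomorphic_on_imp_continuous_on)
    have "cmod (a * z + b) < 1" if "z \<in> unit_disk" for z
      using subsetD[OF disk imageI[OF that]] by (simp add: ab)
    then have le: "(cmod a)\<^sup>2 + (cmod b)\<^sup>2 \<le> 1"
      by (rule affine_disk_self_map_bound)
    \<comment> \<open>A contraction would give the inverse operator an expanding symbol.\<close>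
    have "cmod a \<ge> 1"
    proof (rule ccontr)
      assume "\<not> cmod a \<ge> 1"
      then have a1: "cmod a < 1" by simp
      then have "a \<noteq> 1" by auto
      define p where "p = b / (1 - a)"
      have p: "a * p + b = p" using \<open>a \<noteq> 1\<close> by (simp add: p_def field_simps)
      have "?\<tau> w = p + (1 / a) * (w - p)" for w
      proof -
        have "?\<Theta> (p + (1 / a) * (w - p)) = w"
        proof -
          have "a * (p + (1 / a) * (w - p)) = a * p + (w - p)"
            using a by (simp add: distrib_left)
          then show ?thesis using p unfolding ab by (simp only:) (simp add: algebra_simps)
        qed
        then show ?thesis using symbol_symbol[of "p + (1 / a) * (w - p)"] by (simp add: dom)
      qed
      then have "cmod (1 / a) \<le> 1"
        by (rule inv.affine_symbol_not_expanding[OF PInf])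
      then show False using a a1 by (simp add: norm_divide field_simps)
    qed
    then have "(cmod a)\<^sup>2 \<ge> 1" by simp
    then have "(cmod b)\<^sup>2 \<le> 0" "(cmod a)\<^sup>2 \<le> 1" using le zero_le_power2[of "cmod b"] by linarith+
    then have "b = 0" "cmod a = 1" using \<open>cmod a \<ge> 1\<close>
      by (auto simp: power_le_one_iff abs_square_le_1)
    then show ?thesis by (auto simp: ab)
  next
    case MInf
    then show ?thesis using radius_ge_1 by simp
  qed
qed

end

section \<open>Invertible weighted composition operators\<close>

theorem theorem3p5:
  fixes \<psi> \<phi> :: "complex \<Rightarrow> complex" and \<beta> :: "nat \<Rightarrow> real"
  assumes "\<psi> holomorphic_on unit_disk"
    and "\<phi> holomorphic_on unit_disk"
    and "\<phi> ` unit_disk \<subseteq> unit_disk"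
    and "hardy_weight \<beta>"
    and "bounded_operator \<beta> (weighted_comp_op \<psi> \<phi>)"
    and "invertible_operator \<beta> (weighted_comp_op \<psi> \<phi>)"
  shows "disk_automorphism \<phi> \<and>
    (liminf (\<lambda>j. ereal (root j (\<beta> j))) > 1 \<longrightarrow>
      (\<exists>\<zeta>\<in>sphere 0 1. \<forall>z\<in>unit_disk. \<phi> z = \<zeta> * z))"
proof -
  define T where "T = weighted_comp_op \<psi> \<phi>"
  obtain S where S: "bounded_operator \<beta> S"
    "\<And>f. f \<in> hardy_space \<beta> \<Longrightarrow> S (T f) = f" "\<And>f. f \<in> hardy_space \<beta> \<Longrightarrow> T (S f) = f"
    using assms(6) by (auto simp: invertible_operator_def T_def)
  interpret weighted_hardy \<beta> by unfold_locales (rule assms(4))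
  have T_in: "T (monomial n) \<in> hardy_space \<beta>" for n
    using assms(5) disk_poly_in_hardy_space by (auto simp: bounded_operator_def T_def)
  have on_disk: "extension (T (monomial n)) z = \<psi> z * \<phi> z ^ n" if "z \<in> unit_disk" for n z
  proof -
    have "\<phi> z \<in> unit_disk" using assms(3) that by blast
    then show ?thesis
      using that extension_on_disk[OF hardy_spaceD(1)[OF T_in] that]
      by (simp add: T_def weighted_comp_op_def disk_poly_def poly_monom)
  qed
  interpret multiplicative_isomorphism \<beta> T S
  proof unfold_locales
    fix m n w assume w: "w \<in> domain"
    show "extension (T (monomial m)) w * extension (T (monomial n)) w =
      extension (T (monomial (m + n))) w * extension (T (monomial 0)) w"
    proof (rule analytic_continuation_open[of unit_disk domain
          "\<lambda>w. extension (T (monomial m)) w * extension (T (monomial n)) w"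
          "\<lambda>w. extension (T (monomial (m + n))) w * extension (T (monomial 0)) w"])
      fix z assume "z \<in> unit_disk"
      then show "extension (T (monomial m)) z * extension (T (monomial n)) z =
          extension (T (monomial (m + n))) z * extension (T (monomial 0)) z"
        by (simp only: on_disk power_add power_0) simp
    qed (use w open_domain connected_domain unit_disk_subset_domain in
        \<open>auto intro!: holomorphic_on_mult extension_holomorphic T_in simp del: monom_eq_1\<close>)
  qed (use assms(5) S in \<open>auto simp: T_def\<close>)
  have symbol: "symbol T z = \<phi> z" if "z \<in> unit_disk" for z
  proof -
    have "z \<in> domain" using that unit_disk_subset_domain by blast
    then have "\<psi> z \<noteq> 0"
      using multiplier_nonzero[of z] on_disk[OF that, of 0] by (simp only: multiplier_def power_0) simp
    then show ?thesis
      by (simp only: symbol_def multiplier_def on_disk[OF that]) simp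
  qed
  have rotation: "\<exists>\<zeta>. cmod \<zeta> = 1 \<and> (\<forall>z\<in>unit_disk. \<phi> z = \<zeta> * z)" if "radius > 1"
    using symbol_rotation[OF that] assms(3) symbol by (auto simp: image_subset_iff)
  have "bij_betw \<phi> unit_disk unit_disk"
  proof (cases "radius > 1")
    case True
    then obtain \<zeta> where \<zeta>: "cmod \<zeta> = 1" "\<And>z. z \<in> unit_disk \<Longrightarrow> \<phi> z = \<zeta> * z"
      using rotation by blast
    then have "\<zeta> \<noteq> 0" by auto
    then show ?thesis
      using \<zeta> by (intro bij_betw_byWitness[where f' = "\<lambda>z. z / \<zeta>"]) (auto simp: norm_mult norm_divide)
  next
    case False
    then have "radius = 1" using radius_ge_1 by auto
    then have dom: "domain = unit_disk" by (simp add: domain_def one_ereal_def)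
    interpret inv: multiplicative_isomorphism \<beta> S T by (rule inverse_multiplicative)
    show ?thesis
    proof (rule bij_betw_byWitness[where f' = "symbol S"])
      show "\<forall>z\<in>unit_disk. symbol S (\<phi> z) = z"
        using symbol_symbol symbol dom by fastforce
      show "\<forall>z\<in>unit_disk. \<phi> (symbol S z) = z"
        using inv.symbol_symbol inv.symbol_in_domain symbol dom by fastforce
      show "\<phi> ` unit_disk \<subseteq> unit_disk" by (rule assms(3))
      show "symbol S ` unit_disk \<subseteq> unit_disk"
        using inv.symbol_in_domain dom by blast
    qed
  qed
  then show ?thesis
    using rotation assms(2) unfolding disk_automorphism_def radius_eq_liminf[symmetric]
      sphere_def dist_0_norm by blast
qed

end
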